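(* Let $X$ be a compact Hausdorff space, $\Delta_1\subset X$ clopen, and $\alpha:\Delta_1\to X$ continuous. For $n\ge1$ let $\Delta_n$ be the domain of $\alpha^n$, let $\Delta_0=X$, and let $\alpha_n=\alpha|_{\Delta_n}:\Delta_n\to\Delta_{n-1}$ for $n\ge1$. Let $X_\infty=\{(x_0,x_1,\dots):x_n\in\Delta_n\text{ for }n\ge0,\ \alpha(x_n)=x_{n-1}\text{ for }n\ge1\}$ and let $\Phi_n:X_\infty\to\Delta_n$, $\Phi_n(x_0,x_1,\dots)=x_n$. Then the system $(X_\infty,\Phi_n)_{n\in\mathbb{N}}$ is the projective limit of the projective sequence $(\Delta_n,\alpha_n)_{n\in\mathbb{N}}$: $$X_\infty=\varprojlim(\Delta_n,\alpha_n).$$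
   Context: $\mathbb{N}=\{0,1,2,\dots\}$. $X_\infty$ carries the topology induced from the product $\prod_{n=0}^\infty(X\cup\{0\})$, where $0$ is an isolated point adjoined to $X$ (equivalently, the topology induced from $\prod_{n=0}^\infty\Delta_n$). The projective limit is taken in topological spaces, the bonding maps of the sequence being $\alpha_n:\Delta_n\to\Delta_{n-1}$, $n\ge1$. *)

theory Defs
  imports "HOL-Analysis.Analysis"
begin

definition partial_map :: "'a set \<Rightarrow> ('a \<Rightarrow> 'a) \<Rightarrow> ('a \<rightharpoonup> 'a)" where
  "partial_map D f = (\<lambda>x. if x \<in> D then Some (f x) else None)"

primrec partial_pow :: "('a \<rightharpoonup> 'a) \<Rightarrow> nat \<Rightarrow> ('a \<rightharpoonup> 'a)" where
  "partial_pow p 0 = Some"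
| "partial_pow p (Suc n) = p \<circ>\<^sub>m partial_pow p n"

text \<open>The map \<open>\<alpha>\<close> is given as a total function of which only the values on
  \<open>D\<close> (the set \<open>\<Delta>\<^sub>1\<close>) matter.\<close>

definition Delta :: "'a topology \<Rightarrow> 'a set \<Rightarrow> ('a \<Rightarrow> 'a) \<Rightarrow> nat \<Rightarrow> 'a set" where
  "Delta X D \<alpha> n =
    (if n = 0 then topspace X else dom (partial_pow (partial_map D \<alpha>) n))"

definition Delta_top :: "'a topology \<Rightarrow> 'a set \<Rightarrow> ('a \<Rightarrow> 'a) \<Rightarrow> nat \<Rightarrow> 'a topology" where
  "Delta_top X D \<alpha> n = subtopology X (Delta X D \<alpha> n)"

definition alpha_seq :: "'a topology \<Rightarrow> 'a set \<Rightarrow> ('a \<Rightarrow> 'a) \<Rightarrow> nat \<Rightarrow> 'a \<Rightarrow> 'a" where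
  "alpha_seq X D \<alpha> n = restrict \<alpha> (Delta X D \<alpha> n)"

definition X_infty :: "'a topology \<Rightarrow> 'a set \<Rightarrow> ('a \<Rightarrow> 'a) \<Rightarrow> (nat \<Rightarrow> 'a) set" where
  "X_infty X D \<alpha> =
    {x. (\<forall>n. x n \<in> Delta X D \<alpha> n) \<and> (\<forall>n\<ge>1. \<alpha> (x n) = x (n - 1))}"

definition X_infty_top :: "'a topology \<Rightarrow> 'a set \<Rightarrow> ('a \<Rightarrow> 'a) \<Rightarrow> (nat \<Rightarrow> 'a) topology" where
  "X_infty_top X D \<alpha> =
    subtopology (product_topology (Delta_top X D \<alpha>) UNIV) (X_infty X D \<alpha>)"

definition Phi :: "'a topology \<Rightarrow> 'a set \<Rightarrow> ('a \<Rightarrow> 'a) \<Rightarrow> nat \<Rightarrow> (nat \<Rightarrow> 'a) \<Rightarrow> 'a" where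
  "Phi X D \<alpha> n = restrict (\<lambda>x. x n) (X_infty X D \<alpha>)"

text \<open>A projective sequence of topological spaces has bonding maps
  \<open>f n : Y n \<rightarrow> Y (n - 1)\<close> for \<open>n \<ge> 1\<close>; the value \<open>f 0\<close> is irrelevant.\<close>

definition projective_sequence :: "(nat \<Rightarrow> 'b topology) \<Rightarrow> (nat \<Rightarrow> 'b \<Rightarrow> 'b) \<Rightarrow> bool" where
  "projective_sequence Y f \<longleftrightarrow> (\<forall>n\<ge>1. continuous_map (Y n) (Y (n - 1)) (f n))"

definition projective_cone ::
  "(nat \<Rightarrow> 'b topology) \<Rightarrow> (nat \<Rightarrow> 'b \<Rightarrow> 'b) \<Rightarrow> 'z topology \<Rightarrow> (nat \<Rightarrow> 'z \<Rightarrow> 'b) \<Rightarrow> bool" where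
  "projective_cone Y f Z g \<longleftrightarrow>
    (\<forall>n. continuous_map Z (Y n) (g n)) \<and>
    (\<forall>n\<ge>1. \<forall>z\<in>topspace Z. f n (g n z) = g (n - 1) z)"

text \<open>The projective limit in the category of topological spaces, by its universal
  property. HOL cannot quantify over types inside a formula, so the type \<open>'z\<close> carrying the
  competing spaces \<open>Z\<close> is a parameter; left free in a theorem's conclusion it is universally
  quantified, and so ranges over all types. Maps \<open>Z \<rightarrow> L\<close> are represented by
  extensional functions, which makes \<open>\<exists>!\<close> mean uniqueness on \<open>topspace Z\<close>.\<close>

definition is_projective_limit ::
  "'z itself \<Rightarrow> 'l topology \<Rightarrow> (nat \<Rightarrow> 'l \<Rightarrow> 'b) \<Rightarrow>
    (nat \<Rightarrow> 'b topology) \<Rightarrow> (nat \<Rightarrow> 'b \<Rightarrow> 'b) \<Rightarrow> bool" where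
  "is_projective_limit (T :: 'z itself) L \<pi> Y f \<longleftrightarrow>
    projective_sequence Y f \<and>
    projective_cone Y f L \<pi> \<and>
    (\<forall>(Z :: 'z topology) g. projective_cone Y f Z g \<longrightarrow>
      (\<exists>!h. h \<in> extensional (topspace Z) \<and> continuous_map Z L h \<and>
        (\<forall>n. \<forall>z\<in>topspace Z. \<pi> n (h z) = g n z)))"

end

theory Submission
  imports Defs
begin

text \<open>This is the standard construction of a sequential limit as the space of coherent threads
  inside the product of the \<Delta>_n. Since \<open>Phi\<close> reads off coordinates, a cone (g_n)
  on Z leaves only one candidate for the induced map, z \<mapsto> (g_n(z))_n. The cone equations say
  precisely that its values are threads, and it is continuous because continuity into a subspace of
  a product is checked coordinatewise (\<open>X_infty_universal\<close>). What is particular to a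
  partial map is that \<alpha> really sends \<Delta>_{n+1} into \<Delta>_n. This rests on
  \<open>Delta_Suc\<close>, which exhibits \<Delta>_{n+1} as the preimage of \<Delta>_n under
  \<alpha>, and it gives the bonding maps (\<open>projective_sequence_Delta\<close>).\<close>

text \<open>The recursion splits off the last application of \<open>p\<close>. Splitting off the
  first one instead, by associativity of partial composition, is what describes the domain of a
  power as a preimage.\<close>

lemma partial_pow_Suc_right: "partial_pow p (Suc n) = partial_pow p n \<circ>\<^sub>m p"
proof (induction n)
  case 0
  show ?case
    by (auto simp: map_comp_def fun_eq_iff split: option.splits)
next
  case (Suc n)
  have "partial_pow p (Suc (Suc n)) = p \<circ>\<^sub>m (partial_pow p n \<circ>\<^sub>m p)"
    using Suc by simp
  also have "\<dots> = partial_pow p (Suc n) \<circ>\<^sub>m p"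
    by (auto simp: map_comp_def fun_eq_iff split: option.splits)
  finally show ?case .
qed

lemma Delta_Suc:
  assumes "D \<subseteq> topspace X" and "\<alpha> \<in> D \<rightarrow> topspace X"
  shows "Delta X D \<alpha> (Suc n) = {x \<in> D. \<alpha> x \<in> Delta X D \<alpha> n}"
proof -
  have "Delta X D \<alpha> (Suc n) = {x \<in> D. \<alpha> x \<in> dom (partial_pow (partial_map D \<alpha>) n)}"
    unfolding Delta_def partial_pow_Suc_right
    by (auto simp: partial_map_def map_comp_def split: if_splits)
  \<comment> \<open>The case n = 0 is separate: \<open>partial_pow\<close> gives
    \<open>Some\<close>, whose domain is the whole type, while \<open>Delta\<close> gives
    \<open>topspace X\<close>. Both conditions on \<alpha> x hold for every x in \<open>D\<close>,
    as \<alpha> maps \<open>D\<close> into \<open>topspace X\<close>.\<close>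
  then show ?thesis
    using assms by (cases n) (auto simp: Delta_def)
qed

lemma Delta_subset_topspace:
  assumes "D \<subseteq> topspace X" and "\<alpha> \<in> D \<rightarrow> topspace X"
  shows "Delta X D \<alpha> n \<subseteq> topspace X"
  using assms by (cases n) (auto simp: Delta_Suc, auto simp: Delta_def)

lemma topspace_Delta_top:
  assumes "D \<subseteq> topspace X" and "\<alpha> \<in> D \<rightarrow> topspace X"
  shows "topspace (Delta_top X D \<alpha> n) = Delta X D \<alpha> n"
  using Delta_subset_topspace[OF assms] by (auto simp: Delta_top_def)

lemma topspace_X_infty_top:
  assumes "D \<subseteq> topspace X" and "\<alpha> \<in> D \<rightarrow> topspace X"
  shows "topspace (X_infty_top X D \<alpha>) = X_infty X D \<alpha>"
  by (auto simp: X_infty_top_def topspace_Delta_top[OF assms] X_infty_def)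

text \<open>Continuity is inherited from \<open>D\<close>, which contains \<Delta>_n for n \<ge> 1;
  the smaller codomain is justified by \<open>Delta_Suc\<close>.\<close>

lemma projective_sequence_Delta:
  assumes "D \<subseteq> topspace X" and cont: "continuous_map (subtopology X D) X \<alpha>"
  shows "projective_sequence (Delta_top X D \<alpha>) (alpha_seq X D \<alpha>)"
  unfolding projective_sequence_def
proof (intro allI impI)
  fix n :: nat
  assume "n \<ge> 1"
  then obtain m where n: "n = Suc m"
    by (cases n) auto
  have \<alpha>: "\<alpha> \<in> D \<rightarrow> topspace X"
    using continuous_map_funspace[OF cont] assms(1) by auto
  note Delta_n = Delta_Suc[OF assms(1) \<alpha>, of m]
  have "continuous_map (subtopology X (Delta X D \<alpha> n)) X \<alpha>"
    using cont by (rule continuous_map_from_subtopology_mono) (auto simp: n Delta_n)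
  then have "continuous_map (Delta_top X D \<alpha> n) (Delta_top X D \<alpha> (n - 1)) \<alpha>"
    by (auto simp: Delta_top_def continuous_map_in_subtopology n Delta_n)
  then show "continuous_map (Delta_top X D \<alpha> n) (Delta_top X D \<alpha> (n - 1)) (alpha_seq X D \<alpha> n)"
    by (rule continuous_map_eq) (simp_all add: n alpha_seq_def topspace_Delta_top[OF assms(1) \<alpha>])
qed

lemma projective_cone_Phi:
  assumes "D \<subseteq> topspace X" and "\<alpha> \<in> D \<rightarrow> topspace X"
  shows "projective_cone (Delta_top X D \<alpha>) (alpha_seq X D \<alpha>) (X_infty_top X D \<alpha>) (Phi X D \<alpha>)"
  unfolding projective_cone_def
proof (intro conjI allI impI ballI)
  fix n
  have "continuous_map (X_infty_top X D \<alpha>) (Delta_top X D \<alpha> n) (\<lambda>x. x n)"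
    unfolding X_infty_top_def
    by (intro continuous_map_from_subtopology continuous_map_product_projection) simp
  then show "continuous_map (X_infty_top X D \<alpha>) (Delta_top X D \<alpha> n) (Phi X D \<alpha> n)"
    by (rule continuous_map_eq) (simp add: Phi_def topspace_X_infty_top[OF assms])
next
  fix n :: nat and x
  assume "n \<ge> 1" and "x \<in> topspace (X_infty_top X D \<alpha>)"
  then show "alpha_seq X D \<alpha> n (Phi X D \<alpha> n x) = Phi X D \<alpha> (n - 1) x"
    unfolding topspace_X_infty_top[OF assms] by (simp add: alpha_seq_def Phi_def X_infty_def)
qed

lemma X_infty_universal:
  assumes "D \<subseteq> topspace X" and "\<alpha> \<in> D \<rightarrow> topspace X"
    and cone: "projective_cone (Delta_top X D \<alpha>) (alpha_seq X D \<alpha>) Z g"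
  shows "\<exists>!h. h \<in> extensional (topspace Z) \<and> continuous_map Z (X_infty_top X D \<alpha>) h \<and>
    (\<forall>n. \<forall>z\<in>topspace Z. Phi X D \<alpha> n (h z) = g n z)"
proof (rule ex1I)
  \<comment> \<open>The thread of values of the cone at z, cut down to \<open>topspace Z\<close> to
    make the map extensional.\<close>
  let ?h = "\<lambda>z\<in>topspace Z. \<lambda>n. g n z"
  have g: "continuous_map Z (Delta_top X D \<alpha> n) (g n)" for n
    using cone by (simp add: projective_cone_def)
  have Delta: "g n z \<in> Delta X D \<alpha> n" if "z \<in> topspace Z" for n z
    using continuous_map_funspace[OF g] that topspace_Delta_top[OF assms(1,2)] by blast
  have "(\<lambda>n. g n z) \<in> X_infty X D \<alpha>" if z: "z \<in> topspace Z" for z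
  proof -
    have "\<alpha> (g n z) = g (n - 1) z" if "n \<ge> 1" for n
    proof -
      have "alpha_seq X D \<alpha> n (g n z) = g (n - 1) z"
        using cone that z by (simp add: projective_cone_def)
      \<comment> \<open>\<open>alpha_seq\<close> agrees with \<alpha> only on \<Delta>_n, so the
        cone equation becomes a thread equation only once g_n(z) is known to lie there.\<close>
      then show ?thesis
        using Delta[OF z] by (simp add: alpha_seq_def)
    qed
    then show ?thesis
      using Delta[OF z] by (simp add: X_infty_def)
  qed
  then have mem: "?h z \<in> X_infty X D \<alpha>" if "z \<in> topspace Z" for z
    using that by simp
  have "continuous_map Z (product_topology (Delta_top X D \<alpha>) UNIV) (\<lambda>z n. g n z)"
    using g by (simp add: continuous_map_componentwise_UNIV)
  then have "continuous_map Z (product_topology (Delta_top X D \<alpha>) UNIV) ?h"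
    by (rule continuous_map_eq) simp
  then have "continuous_map Z (X_infty_top X D \<alpha>) ?h"
    unfolding X_infty_top_def using mem by (auto simp: continuous_map_in_subtopology)
  moreover have "Phi X D \<alpha> n (?h z) = g n z" if "z \<in> topspace Z" for n z
    using mem[OF that] that by (simp add: Phi_def)
  ultimately show "?h \<in> extensional (topspace Z) \<and> continuous_map Z (X_infty_top X D \<alpha>) ?h \<and>
      (\<forall>n. \<forall>z\<in>topspace Z. Phi X D \<alpha> n (?h z) = g n z)"
    by blast
  fix h
  assume h: "h \<in> extensional (topspace Z) \<and> continuous_map Z (X_infty_top X D \<alpha>) h \<and>
    (\<forall>n. \<forall>z\<in>topspace Z. Phi X D \<alpha> n (h z) = g n z)"
  show "h = ?h"
  proof (rule extensionalityI)
    fix z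
    assume z: "z \<in> topspace Z"
    \<comment> \<open>\<open>Phi\<close> is \<open>undefined\<close> off \<open>X_infty\<close>, so
      membership has to come first; then the equations for \<open>Phi\<close> determine every
      coordinate of h z.\<close>
    have "h z \<in> X_infty X D \<alpha>"
      using h z continuous_map_funspace topspace_X_infty_top[OF assms(1,2)] by blast
    then have "h z n = g n z" for n
      using h z by (metis Phi_def restrict_apply')
    then show "h z = ?h z"
      using z by auto
  qed (use h in auto)
qed

theorem proposition2p10:
  fixes X :: "'a topology" and \<Delta>\<^sub>1 :: "'a set" and \<alpha> :: "'a \<Rightarrow> 'a"
  assumes "compact_space X" and "Hausdorff_space X"
    and "openin X \<Delta>\<^sub>1" and "closedin X \<Delta>\<^sub>1"
    and "continuous_map (subtopology X \<Delta>\<^sub>1) X \<alpha>"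
  shows "is_projective_limit TYPE('z)
    (X_infty_top X \<Delta>\<^sub>1 \<alpha>) (Phi X \<Delta>\<^sub>1 \<alpha>)
    (Delta_top X \<Delta>\<^sub>1 \<alpha>) (alpha_seq X \<Delta>\<^sub>1 \<alpha>)"
proof -
  have sub: "\<Delta>\<^sub>1 \<subseteq> topspace X"
    using assms(3) by (rule openin_subset)
  then have \<alpha>: "\<alpha> \<in> \<Delta>\<^sub>1 \<rightarrow> topspace X"
    using continuous_map_funspace[OF assms(5)] by auto
  show ?thesis
    unfolding is_projective_limit_def
    using projective_sequence_Delta[OF sub assms(5)] projective_cone_Phi[OF sub \<alpha>]
      X_infty_universal[OF sub \<alpha>]
    by blast
qed

end
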